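(* Let $N$ be a finite nonempty set of players. The value $\Gamma$ satisfies the properties of additivity, necessary players get the $0$-normalized per capita mean, efficiency and symmetry, and it is the unique value $f:\mathcal{G}_N\to\mathbb{R}^N$ for cooperative games that satisfies these four properties.
   Context: Fix a finite nonempty set $N$, $n=|N|$. A cooperative game with player set $N$ is a pair $(N,v)$ with $v:2^N\to\mathbb{R}$, $v(\emptyset)=0$; $\mathcal{G}_N$ is the set of all such games. A value (for cooperative games) is a map $f$ assigning to each $(N,v)\in\mathcal{G}_N$ a vector $f(N,v)\in\mathbb{R}^N$. Lower-case $s$ denotes $|S|$; $\subset$ denotes strict inclusion. A player $i\in N$ is necessary in $(N,v)$ if $v(S)=0$ for all $S\subseteq N\setminus\{i\}$. Players $i,j\in N$ are symmetric in $(N,v)$ if $v(S\cup\{i\})=v(S\cup\{j\})$ for every $S\subseteq N\setminus\{i,j\}$. For a game $(N,v)$ define $v^0(S)=v(S)-\sum_{j\in S}v(\{j\})$ for all $S\subseteq N$. The value $\gamma$ is $$\gamma_i(N,v)=\frac{1}{2^{n-1}}\left(\sum_{S\subset N,\, i\in S}\frac{v(S)}{s}-\sum_{S\subset N,\, i\notin S}\frac{v(S)}{n-s}\right)+\frac{v(N)}{n},$$ and the value $\Gamma$ is $\Gamma_i(N,v)=v(\{i\})+\gamma_i(N,v^0)$, for all $(N,v)\in\mathcal{G}_N$ and $i\in N$. Properties of a value $f$: - Additivity: $f(N,v+w)=f(N,v)+f(N,w)$ for all $(N,v),(N,w)\in\mathcal{G}_N$. - Efficiency: $\sum_{i\in N}f_i(N,v)=v(N)$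 for all $(N,v)\in\mathcal{G}_N$. - Symmetry: $f_i(N,v)=f_j(N,v)$ for all $(N,v)\in\mathcal{G}_N$ and all $i,j$ symmetric in $(N,v)$. - Necessary players get the $0$-normalized per capita mean: for every $(N,v)\in\mathcal{G}_N$ with $v(N)=\sum_{j\in N}v(\{j\})$ and every necessary player $i$ in $(N,v)$, $$f_i(N,v)=v(\{i\})+\frac{1}{2^{n-1}}\sum_{S\subseteq N,\, i\in S}\frac{v^0(S)}{s}.$$ *)

theory Defs
  imports Complex_Main "HOL-Library.FuncSet"
begin

text \<open>
  Characteristic functions are extensional on \<open>Pow N\<close>, so that an element of \<open>games N\<close>
  carries exactly the data of a function \<open>2\<^sup>N \<rightarrow> \<real>\<close>. Hence operations on
  games are restricted to \<open>Pow N\<close>. A value for the player set \<open>N\<close> has type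
  \<open>'a value_map\<close>; only its components \<open>f v i\<close> with \<open>v \<in> games N\<close> and
  \<open>i \<in> N\<close> are meaningful.
\<close>

type_synonym 'a game = "'a set \<Rightarrow> real"
type_synonym 'a value_map = "'a game \<Rightarrow> 'a \<Rightarrow> real"

definition games :: "'a set \<Rightarrow> 'a game set" where
  "games N = {v \<in> Pow N \<rightarrow>\<^sub>E (UNIV :: real set). v {} = 0}"

definition game_add :: "'a set \<Rightarrow> 'a game \<Rightarrow> 'a game \<Rightarrow> 'a game" where
  "game_add N v w = (\<lambda>S\<in>Pow N. v S + w S)"

definition zero_normalized :: "'a set \<Rightarrow> 'a game \<Rightarrow> 'a game" where
  "zero_normalized N v = (\<lambda>S\<in>Pow N. v S - (\<Sum>j\<in>S. v {j}))"

definition necessary :: "'a set \<Rightarrow> 'a game \<Rightarrow> 'a \<Rightarrow> bool" where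
  "necessary N v i \<longleftrightarrow> i \<in> N \<and> (\<forall>S. S \<subseteq> N - {i} \<longrightarrow> v S = 0)"

definition symmetric :: "'a set \<Rightarrow> 'a game \<Rightarrow> 'a \<Rightarrow> 'a \<Rightarrow> bool" where
  "symmetric N v i j \<longleftrightarrow> i \<in> N \<and> j \<in> N \<and>
     (\<forall>S. S \<subseteq> N - {i, j} \<longrightarrow> v (S \<union> {i}) = v (S \<union> {j}))"

definition gamma_value :: "'a set \<Rightarrow> 'a value_map" where
  "gamma_value N v i =
     1 / 2 ^ (card N - 1) *
       ((\<Sum>S | S \<subset> N \<and> i \<in> S. v S / real (card S))
        - (\<Sum>S | S \<subset> N \<and> i \<notin> S. v S / (real (card N) - real (card S))))
     + v N / real (card N)"

definition Gamma_value :: "'a set \<Rightarrow> 'a value_map" where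
  "Gamma_value N v i = v {i} + gamma_value N (zero_normalized N v) i"

definition additivity :: "'a set \<Rightarrow> 'a value_map \<Rightarrow> bool" where
  "additivity N f \<longleftrightarrow>
     (\<forall>v\<in>games N. \<forall>w\<in>games N. \<forall>i\<in>N. f (game_add N v w) i = f v i + f w i)"

definition efficiency :: "'a set \<Rightarrow> 'a value_map \<Rightarrow> bool" where
  "efficiency N f \<longleftrightarrow> (\<forall>v\<in>games N. (\<Sum>i\<in>N. f v i) = v N)"

definition symmetry :: "'a set \<Rightarrow> 'a value_map \<Rightarrow> bool" where
  "symmetry N f \<longleftrightarrow> (\<forall>v\<in>games N. \<forall>i j. symmetric N v i j \<longrightarrow> f v i = f v j)"

definition necessary_per_capita_mean :: "'a set \<Rightarrow> 'a value_map \<Rightarrow> bool" where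
  "necessary_per_capita_mean N f \<longleftrightarrow>
     (\<forall>v\<in>games N. \<forall>i. v N = (\<Sum>j\<in>N. v {j}) \<longrightarrow> necessary N v i \<longrightarrow>
        f v i = v {i} + 1 / 2 ^ (card N - 1) *
          (\<Sum>S | S \<subseteq> N \<and> i \<in> S. zero_normalized N v S / real (card S)))"

end

(*
  Existence: efficiency and symmetry of gamma are double counting and a relabelling of coalitions;
  if i is necessary and v(N) is the sum of the singleton worths, then the 0-normalization of v
  vanishes at N and at all coalitions without i, which leaves the per capita mean.

  Uniqueness: by additivity it suffices to determine the value on games a * delta_T supported on a
  single coalition T. In such a game the players outside T are pairwise symmetric, so efficiency
  determines their payoffs from those of the players in T. If T is not N and has at least two
  players, then the members of T are necessary and the 0-normalized mean property applies. If T = N,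
  all players are symmetric. If T = {k}, that property says nothing about a * delta_T itself, but it
  applies to a * delta_T + a * delta_N, and additivity recovers a * delta_T.
*)
theory Submission
  imports Defs "HOL-Combinatorics.Transposition"
begin

section \<open>Games as extensional functions and additivity of 0-normalization\<close>

lemma gamesD: "v \<in> games N \<Longrightarrow> v {} = 0"
  by (simp add: games_def)

lemma games_eqI:
  assumes "v \<in> games N" "w \<in> games N" "\<And>S. S \<subseteq> N \<Longrightarrow> S \<noteq> {} \<Longrightarrow> v S = w S"
  shows "v = w"
proof (rule PiE_ext)
  show "v \<in> Pow N \<rightarrow>\<^sub>E UNIV" "w \<in> Pow N \<rightarrow>\<^sub>E UNIV"
    using assms by (auto simp: games_def)
  show "v S = w S" if "S \<in> Pow N" for S
    using that assms by (cases "S = {}") (auto simp: gamesD)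
qed

lemma game_add_in_games: "v \<in> games N \<Longrightarrow> w \<in> games N \<Longrightarrow> game_add N v w \<in> games N"
  by (auto simp: games_def game_add_def)

lemma zero_normalized_in_games: "v \<in> games N \<Longrightarrow> zero_normalized N v \<in> games N"
  by (auto simp: games_def zero_normalized_def)

lemma zero_normalized_add:
  assumes "S \<subseteq> N"
  shows "zero_normalized N (game_add N v w) S = zero_normalized N v S + zero_normalized N w S"
proof -
  have "(\<Sum>j\<in>S. game_add N v w {j}) = (\<Sum>j\<in>S. v {j} + w {j})"
    using assms by (intro sum.cong) (auto simp: game_add_def)
  then show ?thesis
    using assms by (simp add: zero_normalized_def game_add_def sum.distrib)
qed

section \<open>The four properties of \<open>\<Gamma>\<close>\<close>

text \<open>The formula is linear in the worths and reads them only at subsets of \<open>N\<close>.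
  The pointwise hypothesis is what \<open>zero_normalized_add\<close> supplies.\<close>

lemma gamma_value_add:
  assumes "\<And>S. S \<subseteq> N \<Longrightarrow> u S = v S + w S"
  shows "gamma_value N u i = gamma_value N v i + gamma_value N w i"
proof -
  have "(\<Sum>S | S \<subset> N \<and> i \<in> S. u S / real (card S))
      = (\<Sum>S | S \<subset> N \<and> i \<in> S. v S / real (card S) + w S / real (card S))"
    by (intro sum.cong) (auto simp: assms psubset_imp_subset add_divide_distrib)
  moreover have "(\<Sum>S | S \<subset> N \<and> i \<notin> S. u S / (real (card N) - real (card S)))
      = (\<Sum>S | S \<subset> N \<and> i \<notin> S. v S / (real (card N) - real (card S))
          + w S / (real (card N) - real (card S)))"
    by (intro sum.cong) (auto simp: assms psubset_imp_subset add_divide_distrib)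
  ultimately show ?thesis
    by (simp add: gamma_value_def assms sum.distrib add_divide_distrib diff_divide_distrib)
qed

lemma additivity_Gamma: "additivity N (Gamma_value N)"
  unfolding additivity_def Gamma_value_def
proof (intro ballI)
  fix v w i assume "i \<in> N"
  then show "game_add N v w {i} + gamma_value N (zero_normalized N (game_add N v w)) i
      = v {i} + gamma_value N (zero_normalized N v) i
        + (w {i} + gamma_value N (zero_normalized N w) i)"
    by (subst gamma_value_add[OF zero_normalized_add]) (simp_all add: game_add_def)
qed

text \<open>A proper nonempty coalition \<open>S\<close> gives v(S)/s to each of its s members and
  takes v(S)/(n-s) from each of the n-s outsiders, so its contributions cancel in the total. Only n
  times v(N)/n remains.\<close>

lemma sum_gamma_value:
  assumes "finite N" "N \<noteq> {}" "v {} = 0"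
  shows "(\<Sum>i\<in>N. gamma_value N v i) = v N"
proof -
  let ?P = "{S. S \<subset> N}"
  have fin: "finite ?P"
    by (rule finite_subset[of _ "Pow N"]) (use assms in auto)
  have "(\<Sum>i\<in>N. \<Sum>S | S \<subset> N \<and> i \<in> S. v S / real (card S))
      = (\<Sum>S\<in>?P. \<Sum>i | i \<in> N \<and> i \<in> S. v S / real (card S))"
    using sum.swap_restrict[OF assms(1) fin, of "\<lambda>i S. v S / real (card S)" "\<lambda>i S. i \<in> S"]
    by simp
  also have "\<dots> = (\<Sum>S\<in>?P. v S)"
  proof (intro sum.cong refl)
    fix S assume "S \<in> ?P"
    then have S: "{i. i \<in> N \<and> i \<in> S} = S" "finite S"
      using assms(1) by (auto intro: finite_subset)
    \<comment> \<open>The empty coalition has no members to sum over; \<open>v {} = 0\<close> makes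
      it fit.\<close>
    show "(\<Sum>i | i \<in> N \<and> i \<in> S. v S / real (card S)) = v S"
      unfolding S(1) using S(2) assms(3) by (cases "S = {}") auto
  qed
  finally have 1: "(\<Sum>i\<in>N. \<Sum>S | S \<subset> N \<and> i \<in> S. v S / real (card S)) = (\<Sum>S\<in>?P. v S)" .
  have "(\<Sum>i\<in>N. \<Sum>S | S \<subset> N \<and> i \<notin> S. v S / (real (card N) - real (card S)))
      = (\<Sum>S\<in>?P. \<Sum>i | i \<in> N \<and> i \<notin> S. v S / (real (card N) - real (card S)))"
    using sum.swap_restrict[OF assms(1) fin,
        of "\<lambda>i S. v S / (real (card N) - real (card S))" "\<lambda>i S. i \<notin> S"]
    by simp
  also have "\<dots> = (\<Sum>S\<in>?P. v S)"
  proof (intro sum.cong refl)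
    fix S assume "S \<in> ?P"
    then have S: "{i. i \<in> N \<and> i \<notin> S} = N - S" "S \<subset> N" "finite S"
      using assms(1) by (auto intro: finite_subset)
    \<comment> \<open>Properness of \<open>S\<close> makes n-s nonzero, so the division
      cancels.\<close>
    have "card S < card N"
      using S assms(1) by (simp add: psubset_card_mono)
    moreover have "real (card (N - S)) = real (card N) - real (card S)"
      using S(2,3) calculation by (simp add: card_Diff_subset of_nat_diff psubset_imp_subset)
    ultimately show
      "(\<Sum>i | i \<in> N \<and> i \<notin> S. v S / (real (card N) - real (card S))) = v S"
      unfolding S(1) by simp
  qed
  finally have 2: "(\<Sum>i\<in>N. \<Sum>S | S \<subset> N \<and> i \<notin> S. v S / (real (card N) - real (card S)))
      = (\<Sum>S\<in>?P. v S)" .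
  have "card N > 0"
    using assms by (simp add: card_gt_0_iff)
  then show ?thesis
    by (simp add: gamma_value_def sum.distrib sum_subtractf 1 2
        flip: sum_distrib_left sum_divide_distrib)
qed

lemma efficiency_Gamma:
  assumes "finite N" "N \<noteq> {}"
  shows "efficiency N (Gamma_value N)"
  unfolding efficiency_def
proof
  fix v assume "v \<in> games N"
  then have "zero_normalized N v {} = 0"
    by (rule gamesD[OF zero_normalized_in_games])
  \<comment> \<open>The singleton worths that 0-normalization subtracts at \<open>N\<close> are
    exactly those that Gamma pays back.\<close>
  then show "(\<Sum>i\<in>N. Gamma_value N v i) = v N"
    using assms
    by (simp add: Gamma_value_def sum.distrib sum_gamma_value) (simp add: zero_normalized_def)
qed

text \<open>Symmetry at the empty coalition gives \<open>v {i} = v {j}\<close>, so the same amount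
  is subtracted from the worths of \<open>S \<union> {i}\<close> and
  \<open>S \<union> {j}\<close>.\<close>

lemma symmetric_zero_normalized:
  assumes "finite N" "symmetric N v i j"
  shows "symmetric N (zero_normalized N v) i j"
proof (cases "i = j")
  case True
  then show ?thesis
    using assms(2) by (simp add: symmetric_def)
next
  case False
  have ij: "i \<in> N" "j \<in> N" and sym: "\<And>S. S \<subseteq> N - {i, j} \<Longrightarrow> v (S \<union> {i}) = v (S \<union> {j})"
    using assms(2) by (auto simp: symmetric_def)
  have "v {i} = v {j}"
    using sym[of "{}"] by simp
  moreover have "i \<notin> S" "j \<notin> S" "finite S" "S \<subseteq> N" if "S \<subseteq> N - {i, j}" for S
    using that assms(1) by (auto intro: finite_subset)
  ultimately show ?thesis
    using ij sym by (auto simp: symmetric_def zero_normalized_def)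
qed

text \<open>Swapping \<open>i\<close> and \<open>j\<close> fixes a coalition containing both or
  neither of them; in the other two cases it trades one for the other, and symmetry applies.\<close>

lemma symmetric_transpose_image:
  assumes "symmetric N v i j" "S \<subseteq> N"
  shows "v (transpose i j ` S) = v S"
proof -
  have sym: "\<And>S. S \<subseteq> N - {i, j} \<Longrightarrow> v (insert i S) = v (insert j S)"
    using assms(1) by (auto simp: symmetric_def)
  have fix_T: "transpose i j ` T = T" if "T \<subseteq> N - {i, j}" for T
    using that by (force simp: transpose_def image_iff)
  have T: "S - {i, j} \<subseteq> N - {i, j}"
    using assms(2) by auto
  consider "S = S - {i, j}" | "S = insert i (S - {i, j})" | "S = insert j (S - {i, j})"
    | "S = insert i (insert j (S - {i, j}))"
    by blast
  then show ?thesis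
  proof cases
    case 1
    then show ?thesis
      using fix_T[OF T] by simp
  next
    case 2
    then have "transpose i j ` S = insert j (S - {i, j})"
      by (metis fix_T[OF T] image_insert transpose_apply_first)
    with 2 sym[OF T] show ?thesis
      by simp
  next
    case 3
    then have "transpose i j ` S = insert i (S - {i, j})"
      by (metis fix_T[OF T] image_insert transpose_apply_second)
    with 3 sym[OF T] show ?thesis
      by simp
  next
    case 4
    then have "transpose i j ` S = insert j (insert i (S - {i, j}))"
      by (metis fix_T[OF T] image_insert transpose_apply_first transpose_apply_second)
    with 4 show ?thesis
      by (simp add: insert_commute)
  qed
qed

text \<open>The swap acts as an involution on the proper coalitions that preserves size and worth
  and exchanges those containing \<open>i\<close> with those containing \<open>j\<close>; both sums
  are reindexed along it.\<close>

lemma gamma_value_symmetric: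
  assumes "symmetric N v i j"
  shows "gamma_value N v i = gamma_value N v j"
proof -
  let ?\<pi> = "(`) (transpose i j)"
  have ij: "i \<in> N" "j \<in> N"
    using assms by (auto simp: symmetric_def)
  have inv: "?\<pi> (?\<pi> S) = S" for S
    by (simp add: image_image)
  have N: "?\<pi> N = N"
    using ij by (simp add: transpose_image_eq)
  have sub: "?\<pi> S \<subset> N" if "S \<subset> N" for S
    by (metis N image_mono inv psubset_eq that)
  have mem: "a \<in> ?\<pi> S \<longleftrightarrow> transpose i j a \<in> S" for a S
    by (metis image_iff transpose_involutory)
  have card: "card (?\<pi> S) = card S" for S
    by (simp add: card_image)
  have v: "v (?\<pi> S) = v S" if "S \<subset> N" for S
    using symmetric_transpose_image[OF assms] that by auto
  have "(\<Sum>S | S \<subset> N \<and> i \<in> S. v S / real (card S))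
      = (\<Sum>S | S \<subset> N \<and> j \<in> S. v S / real (card S))"
    by (rule sum.reindex_bij_witness[of _ ?\<pi> ?\<pi>]) (simp_all only: mem_Collect_eq inv mem card v sub
        transpose_apply_first transpose_apply_second simp_thms)
  moreover have "(\<Sum>S | S \<subset> N \<and> i \<notin> S. v S / (real (card N) - real (card S)))
      = (\<Sum>S | S \<subset> N \<and> j \<notin> S. v S / (real (card N) - real (card S)))"
    by (rule sum.reindex_bij_witness[of _ ?\<pi> ?\<pi>]) (simp_all only: mem_Collect_eq inv mem card v sub
        transpose_apply_first transpose_apply_second simp_thms)
  ultimately show ?thesis
    by (simp add: gamma_value_def)
qed

lemma symmetry_Gamma:
  assumes "finite N"
  shows "symmetry N (Gamma_value N)"
  unfolding symmetry_def
proof (intro ballI allI impI)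
  fix v i j assume sym: "symmetric N v i j"
  then have "v ({} \<union> {i}) = v ({} \<union> {j})"
    unfolding symmetric_def by blast
  with gamma_value_symmetric[OF symmetric_zero_normalized[OF assms sym]]
  show "Gamma_value N v i = Gamma_value N v j"
    by (simp add: Gamma_value_def)
qed

lemma necessary_per_capita_mean_Gamma:
  assumes "finite N"
  shows "necessary_per_capita_mean N (Gamma_value N)"
  unfolding necessary_per_capita_mean_def
proof (intro ballI allI impI)
  fix v i assume vN: "v N = (\<Sum>j\<in>N. v {j})" and nec: "necessary N v i"
  let ?u = "zero_normalized N v"
  have i: "i \<in> N" and v0: "\<And>S. S \<subseteq> N \<Longrightarrow> i \<notin> S \<Longrightarrow> v S = 0"
    using nec by (auto simp: necessary_def)
  have uN: "?u N = 0"
    using vN by (simp add: zero_normalized_def)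
  have "?u S = 0" if "S \<subseteq> N" "i \<notin> S" for S
  proof -
    \<comment> \<open>Every \<open>j\<close> in \<open>S\<close> differs from \<open>i\<close>, so
      \<open>{j}\<close> avoids the necessary player.\<close>
    have "(\<Sum>j\<in>S. v {j}) = 0"
      using that by (intro sum.neutral) (auto intro!: v0)
    then show ?thesis
      using that by (simp add: zero_normalized_def v0)
  qed
  then have "(\<Sum>S | S \<subset> N \<and> i \<notin> S. ?u S / (real (card N) - real (card S))) = 0"
    by (intro sum.neutral) auto
  \<comment> \<open>The two index sets differ only in \<open>N\<close>, where \<open>?u\<close>
    vanishes.\<close>
  moreover have "(\<Sum>S | S \<subset> N \<and> i \<in> S. ?u S / real (card S))
      = (\<Sum>S | S \<subseteq> N \<and> i \<in> S. ?u S / real (card S))"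
    using assms uN by (intro sum.mono_neutral_left) auto
  ultimately show "Gamma_value N v i = v {i} + 1 / 2 ^ (card N - 1) *
      (\<Sum>S | S \<subseteq> N \<and> i \<in> S. ?u S / real (card S))"
    by (simp add: Gamma_value_def gamma_value_def uN)
qed

section \<open>Uniqueness\<close>

text \<open>The weight \<open>a\<close> is built in because additivity of a value does not provide
  homogeneity.\<close>

definition dirac_game :: "'a set \<Rightarrow> 'a set \<Rightarrow> real \<Rightarrow> 'a game" where
  "dirac_game N T a = (\<lambda>S\<in>Pow N. if S = T then a else 0)"

lemma dirac_game_apply: "S \<subseteq> N \<Longrightarrow> dirac_game N T a S = (if S = T then a else 0)"
  by (simp add: dirac_game_def)

lemma dirac_game_in_games: "T \<noteq> {} \<Longrightarrow> dirac_game N T a \<in> games N"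
  by (auto simp: games_def dirac_game_def)

text \<open>Once the players in \<open>T\<close> are paid, efficiency fixes the remainder and
  symmetry splits it equally among the players outside \<open>T\<close>.\<close>

lemma efficient_symmetric_eqI:
  assumes "finite N" "T \<subseteq> N" "v \<in> games N"
    and "efficiency N f" "symmetry N f" "efficiency N g" "symmetry N g"
    and sym: "\<And>i j. i \<in> N - T \<Longrightarrow> j \<in> N - T \<Longrightarrow> symmetric N v i j"
    and eq: "\<And>i. i \<in> T \<Longrightarrow> f v i = g v i"
    and "i \<in> N"
  shows "f v i = g v i"
proof (cases "i \<in> T")
  case False
  then have i: "i \<in> N - T"
    using assms by blast
  have *: "h v i = (v N - (\<Sum>j\<in>T. h v j)) / real (card (N - T))"
    if "efficiency N h" "symmetry N h" for h :: "'a value_map"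
  proof -
    have "(\<Sum>j\<in>N - T. h v j) = (\<Sum>j\<in>N - T. h v i)"
      using that(2) sym i assms(3) by (intro sum.cong) (auto simp: symmetry_def)
    moreover have "(\<Sum>j\<in>N. h v j) = (\<Sum>j\<in>N - T. h v j) + (\<Sum>j\<in>T. h v j)"
      using assms(2,1) by (rule sum.subset_diff)
    moreover have "(\<Sum>j\<in>N. h v j) = v N"
      using that(1) assms(3) by (simp add: efficiency_def)
    moreover have "card (N - T) > 0"
      using i assms(1) by (auto simp: card_gt_0_iff)
    ultimately show ?thesis
      by (simp add: field_simps)
  qed
  have "(\<Sum>j\<in>T. f v j) = (\<Sum>j\<in>T. g v j)"
    using eq by simp
  then show ?thesis
    using *[of f] *[of g] assms by simp
qed (use eq in auto)

text \<open>For distinct \<open>i\<close> and \<open>j\<close>, the coalition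
  \<open>S \<union> {i}\<close> misses \<open>j\<close> and contains \<open>i\<close>, hence is
  neither \<open>N\<close> nor \<open>T\<close>; likewise with the roles exchanged. Both worths are
  0.\<close>

lemma symmetric_game_outside:
  assumes "i \<in> N - T" "j \<in> N - T" "\<And>S. S \<subset> N \<Longrightarrow> S \<noteq> T \<Longrightarrow> v S = 0"
  shows "symmetric N v i j"
  unfolding symmetric_def
proof (intro conjI allI impI)
  fix S assume S: "S \<subseteq> N - {i, j}"
  show "v (S \<union> {i}) = v (S \<union> {j})"
  proof (cases "i = j")
    case False
    then have "S \<union> {i} \<subset> N" "S \<union> {j} \<subset> N"
      using S assms by auto
    moreover have "S \<union> {i} \<noteq> T" "S \<union> {j} \<noteq> T"
      using assms by auto
    ultimately show ?thesis
      by (simp add: assms(3))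
  qed simp
qed (use assms in auto)

text \<open>A coalition avoiding some \<open>k\<close> in \<open>T\<close> is neither
  \<open>N\<close> nor \<open>T\<close>, so \<open>k\<close> is necessary and the mean property
  fixes its payoff. The worth of \<open>N\<close> may be nonzero, so that the corrected game for a
  singleton \<open>T\<close> is covered too.\<close>

lemma values_eq_single_coalition:
  fixes f g :: "'a value_map"
  assumes "finite N" "T \<subseteq> N" "v \<in> games N"
    and f: "necessary_per_capita_mean N f" "efficiency N f" "symmetry N f"
    and g: "necessary_per_capita_mean N g" "efficiency N g" "symmetry N g"
    and v: "\<And>S. S \<subset> N \<Longrightarrow> S \<noteq> T \<Longrightarrow> v S = 0" "v N = (\<Sum>j\<in>N. v {j})"
    and "i \<in> N"
  shows "f v i = g v i"
proof (rule efficient_symmetric_eqI[of N T v f g])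
  show "f v k = g v k" if "k \<in> T" for k
  proof -
    have "necessary N v k"
      unfolding necessary_def using that assms(2) by (auto intro!: v(1))
    then show ?thesis
      using f(1) g(1) assms(3) v(2) by (simp add: necessary_per_capita_mean_def)
  qed
qed (use assms in \<open>auto intro!: symmetric_game_outside\<close>)

lemma value_eq_dirac_game:
  fixes f g :: "'a value_map"
  assumes "finite N" "T \<subseteq> N" "T \<noteq> {}"
    and f: "additivity N f" "necessary_per_capita_mean N f" "efficiency N f" "symmetry N f"
    and g: "additivity N g" "necessary_per_capita_mean N g" "efficiency N g" "symmetry N g"
    and "i \<in> N"
  shows "f (dirac_game N T a) i = g (dirac_game N T a) i"
proof -
  \<comment> \<open>All players are symmetric here, so no payoff has to be known in advance. The
    result serves both \<open>T = N\<close> and the singleton case.\<close>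
  have full: "f (dirac_game N N a) i = g (dirac_game N N a) i"
  proof (rule efficient_symmetric_eqI[of N "{}" _ f g])
    show "dirac_game N N a \<in> games N"
      using \<open>i \<in> N\<close> by (auto intro!: dirac_game_in_games)
    show "symmetric N (dirac_game N N a) j k" if "j \<in> N - {}" "k \<in> N - {}" for j k
      using that by (rule symmetric_game_outside) (auto simp: dirac_game_apply)
  qed (use assms in auto)
  consider "T = N" | "T \<noteq> N" "\<nexists>k. T = {k}" | k where "T \<noteq> N" "T = {k}"
    by blast
  then show ?thesis
  proof cases
    case 1
    then show ?thesis
      using full by simp
  next
    case 2
    have "(\<Sum>j\<in>N. dirac_game N T a {j}) = 0"
      using 2 by (intro sum.neutral) (auto simp: dirac_game_apply)
    then have "dirac_game N T a N = (\<Sum>j\<in>N. dirac_game N T a {j})"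
      using 2 by (simp add: dirac_game_apply)
    moreover have "dirac_game N T a S = 0" if "S \<subset> N" "S \<noteq> T" for S
      using that by (simp add: dirac_game_apply psubset_imp_subset)
    ultimately show ?thesis
      by (rule values_eq_single_coalition[OF assms(1,2) dirac_game_in_games[OF assms(3)]
            f(2-4) g(2-4) _ _ \<open>i \<in> N\<close>, rotated])
  next
    case 3
    let ?u = "dirac_game N T a" and ?w = "dirac_game N N a"
    have games: "?u \<in> games N" "?w \<in> games N"
      using assms by (auto intro!: dirac_game_in_games)
    have kN: "k \<in> N"
      using 3 assms(2) by auto
    \<comment> \<open>A singleton \<open>N\<close> containing \<open>k\<close> would equal
      \<open>T\<close>. Hence \<open>?w\<close> adds nothing to the singleton worths.\<close>
    have sing: "{j} \<noteq> N" for j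
      using 3 kN by auto
    have zero: "game_add N ?u ?w S = 0" if "S \<subset> N" "S \<noteq> T" for S
      using that by (auto simp: game_add_def dirac_game_apply)
    \<comment> \<open>The singleton worths sum to \<open>a\<close>, all from \<open>{k}\<close>;
      giving \<open>?w\<close> the same weight \<open>a\<close> makes the worth of \<open>N\<close>
      match.\<close>
    have "(\<Sum>j\<in>N. game_add N ?u ?w {j}) = (\<Sum>j\<in>N. if j = k then a else 0)"
      using 3 sing by (intro sum.cong) (auto simp: game_add_def dirac_game_apply)
    also have "\<dots> = game_add N ?u ?w N"
      using assms(1) 3 kN by (auto simp: game_add_def dirac_game_apply)
    finally have "f (game_add N ?u ?w) i = g (game_add N ?u ?w) i"
      by (intro values_eq_single_coalition[OF assms(1,2) game_add_in_games[OF games]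
            f(2-4) g(2-4) zero _ \<open>i \<in> N\<close>]) simp_all
    \<comment> \<open>By additivity, subtracting the payoffs in \<open>?w\<close>, equal by
      \<open>full\<close>, leaves those in \<open>?u\<close>.\<close>
    then show ?thesis
      using f(1) g(1) games full \<open>i \<in> N\<close> unfolding additivity_def by force
  qed
qed

lemma value_unique:
  fixes f g :: "'a value_map"
  assumes "finite N"
    and f: "additivity N f" "necessary_per_capita_mean N f" "efficiency N f" "symmetry N f"
    and g: "additivity N g" "necessary_per_capita_mean N g" "efficiency N g" "symmetry N g"
    and "v \<in> games N" "i \<in> N"
  shows "f v i = g v i"
proof -
  \<comment> \<open>These games lead from the zero game to \<open>v\<close>, one coalition at a
    time.\<close>
  define r where "r A = (\<lambda>S\<in>Pow N. if S \<in> A then v S else 0)" for A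
  have r_games: "r A \<in> games N" for A
    using assms by (auto simp: r_def games_def)
  have "f (r A) i = g (r A) i" if "finite A" "A \<subseteq> Pow N - {{}}" for A
    using that
  proof (induction A rule: finite_induct)
    case empty
    \<comment> \<open>The zero game is its own double, so additivity forces payoff 0.\<close>
    have "game_add N (r {}) (r {}) = r {}"
      by (auto simp: game_add_def r_def)
    then have zero: "h (r {}) i = 0" if "additivity N h" for h :: "'a value_map"
      using that r_games[of "{}"] \<open>i \<in> N\<close> unfolding additivity_def by force
    show ?case
      using zero[OF f(1)] zero[OF g(1)] by simp
  next
    case (insert T A)
    have T: "dirac_game N T (v T) \<in> games N"
      using insert by (intro dirac_game_in_games) auto
    \<comment> \<open>Since \<open>T\<close> is not in \<open>A\<close>, the two summands have
      disjoint supports.\<close>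
    have "r (insert T A) = game_add N (dirac_game N T (v T)) (r A)"
      using insert by (intro games_eqI[OF r_games game_add_in_games[OF T r_games]])
        (auto simp: r_def game_add_def dirac_game_apply)
    moreover have "f (dirac_game N T (v T)) i = g (dirac_game N T (v T)) i"
      using insert assms by (intro value_eq_dirac_game) auto
    ultimately show ?case
      using insert f(1) g(1) T r_games \<open>i \<in> N\<close> by (simp add: additivity_def)
  qed
  \<comment> \<open>The empty coalition is left out, as a nonzero worth there would not give a game;
    \<open>v\<close> is 0 there anyway.\<close>
  moreover have "r (Pow N - {{}}) = v"
    by (intro games_eqI[OF r_games \<open>v \<in> games N\<close>]) (auto simp: r_def)
  ultimately show ?thesis
    using assms(1) by (metis finite_Diff finite_Pow_iff subset_refl)
qed

theorem theorem7:
  fixes N :: "'a set"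
  assumes "finite N" and "N \<noteq> {}"
  shows "(additivity N (Gamma_value N) \<and> necessary_per_capita_mean N (Gamma_value N) \<and>
          efficiency N (Gamma_value N) \<and> symmetry N (Gamma_value N)) \<and>
         (\<forall>f :: 'a value_map.
            additivity N f \<and> necessary_per_capita_mean N f \<and> efficiency N f \<and> symmetry N f \<longrightarrow>
            (\<forall>v\<in>games N. \<forall>i\<in>N. f v i = Gamma_value N v i))"
proof (intro conjI allI impI ballI)
  show additivity: "additivity N (Gamma_value N)"
    by (rule additivity_Gamma)
  show mean: "necessary_per_capita_mean N (Gamma_value N)"
    using assms(1) by (rule necessary_per_capita_mean_Gamma)
  show efficiency: "efficiency N (Gamma_value N)"
    using assms by (rule efficiency_Gamma)
  show symmetry: "symmetry N (Gamma_value N)"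
    using assms(1) by (rule symmetry_Gamma)
  show "f v i = Gamma_value N v i"
    if "additivity N f \<and> necessary_per_capita_mean N f \<and> efficiency N f \<and> symmetry N f"
      and "v \<in> games N" "i \<in> N" for f :: "'a value_map" and v i
    using value_unique[OF assms(1) _ _ _ _ additivity mean efficiency symmetry] that by blast
qed

end
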